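(* Let $\xi_1,\dots,\xi_K:[0,\infty)\to\mathbb{R}$ be basis functions and let $\phi=\sum_{k=1}^K c_k^{\mathrm{true}}\xi_k$ with $\mathbf{c}^{\mathrm{true}}\in\mathbb{R}^K$. Fix observation times $0=t_1<\dots<t_L=T$. For $m=1,2,\dots$ let $\mathbf{x}^{(m)}=(\mathbf{x}^{(m)}_1,\dots,\mathbf{x}^{(m)}_N)$ be trajectories on $[0,T]$ of the asymmetric (Motsch–Tadmor) system of $N$ agents in $\mathbb{R}^d$ with interaction kernel $\phi$, and let $\mathbb{A}_{M,L}\in\mathbb{R}^{dNML\times K}$ be the matrix obtained by stacking vertically the blocks $$\mathbf{A}^{(m,l)}_{ik}=\sum_{j=1}^{N}\xi_k\big(\|\mathbf{x}_j^{(m)}(t_l)-\mathbf{x}_i^{(m)}(t_l)\|\big)\Big(\dot{\mathbf{x}}_i^{(m)}(t_l)-\big(\mathbf{x}_j^{(m)}(t_l)-\mathbf{x}_i^{(m)}(t_l)\big)\Big)\in\mathbb{R}^d$$ over $1\le m\le M$, $1\le l\le L$, $1\le i\le N$ (the column index being $k=1,\dots,K$). Assume that the initial conditions $\mathbf{x}_1(0),\dots,\mathbf{x}_N(0)$ are i.i.d. samples from a probability distribution $\mu_0$ (independently over the trials $m$). Then, with $L$ fixed, $$\lim_{M\to\infty}\frac{1}{NML}\mathbb{A}_{M,L}^{T}\mathbb{A}_{M,L}=\mathbb{B}\in\mathbb{R}^{K\times K}\quad\text{almost surely},$$ where $$\mathbb{B}_{kk'}=\frac{1}{LN}\sum_{\ell=1}^{L}\mathbb{E}_{\mu_0}\Big[\sum_{i=1}^{N}\sum_{j=1}^{N}\sum_{j'=1}^{N}\xi_k(\|\mathbf{r}_{ij}(t_\ell)\|)\,\xi_{k'}(\|\mathbf{r}_{ij'}(t_\ell)\|)\,\big\langle\dot{\mathbf{x}}_i(t_\ell)-\mathbf{r}_{ij}(t_\ell),\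 \dot{\mathbf{x}}_i(t_\ell)-\mathbf{r}_{ij'}(t_\ell)\big\rangle\Big],$$ with $\mathbf{r}_{ij}(t)=\mathbf{x}_j(t)-\mathbf{x}_i(t)$. If $\mathrm{rank}(\mathbb{B})=K-1$, then the true coefficients $\mathbf{c}^{\mathrm{true}}$ can be identified up to a scaling factor, i.e. $\ker(\mathbb{B})=\mathrm{span}\{\mathbf{c}^{\mathrm{true}}\}$.
   Context: The asymmetric (Motsch–Tadmor) system with interaction kernel $\phi:[0,\infty)\to\mathbb{R}$ for $N$ agents $\mathbf{x}_1(t),\dots,\mathbf{x}_N(t)\in\mathbb{R}^d$ is $$\dot{\mathbf{x}}_i(t)=\sum_{j=1}^N\frac{\phi(\|\mathbf{x}_j(t)-\mathbf{x}_i(t)\|)}{\sum_{j'=1}^N\phi(\|\mathbf{x}_{j'}(t)-\mathbf{x}_i(t)\|)}\,(\mathbf{x}_j(t)-\mathbf{x}_i(t)),\qquad i=1,\dots,N.$$ The superscript $(m)$ labels independent trials, each observed without noise (positions and velocities) at the times $t_1,\dots,t_L$; the initial conditions are sampled i.i.d. from a probability measure $\mu_0$ on $\mathbb{R}^d$. $\mathbb{E}_{\mu_0}$ denotes expectation over a single trajectory $\mathbf{x}=(\mathbf{x}_1,\dots,\mathbf{x}_N)$ whose initial positions $\mathbf{x}_1(0),\dots,\mathbf{x}_N(0)$ are i.i.d. with law $\mu_0$. $\|\cdot\|$ and $\langle\cdot,\cdot\rangle$ are the Euclidean norm and inner product. *)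

theory Defs
  imports "HOL-Probability.Probability"
begin

text \<open>
  A configuration of the agents is a function \<open>'n \<Rightarrow> real^'d\<close>: the number of agents is \<open>CARD('n)\<close>
  and the dimension of the state space is \<open>CARD('d)\<close>. A trajectory is a function from time to
  configurations; only its restriction to \<open>{0..T}\<close> matters.
\<close>

type_synonym ('n, 'd) config = "'n \<Rightarrow> real^'d"
type_synonym ('n, 'd) trajectory = "real \<Rightarrow> ('n, 'd) config"

definition mt_normalizer :: "(real \<Rightarrow> real) \<Rightarrow> ('n::finite, 'd::finite) config \<Rightarrow> 'n \<Rightarrow> real" where
  "mt_normalizer \<phi> x i = (\<Sum>j\<in>UNIV. \<phi> (norm (x j - x i)))"

definition mt_rhs :: "(real \<Rightarrow> real) \<Rightarrow> ('n::finite, 'd::finite) config \<Rightarrow> 'n \<Rightarrow> real^'d" where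
  "mt_rhs \<phi> x i = (\<Sum>j\<in>UNIV. (\<phi> (norm (x j - x i)) / mt_normalizer \<phi> x i) *\<^sub>R (x j - x i))"

text \<open>
  The normalizers are required not to vanish along a solution: otherwise the quotients in the
  system are undefined, and \<open>x / 0 = 0\<close> would give them a spurious meaning. At the end points of
  \<open>{0..T}\<close> the derivative is one-sided.
\<close>

definition mt_solution ::
    "(real \<Rightarrow> real) \<Rightarrow> real \<Rightarrow> ('n::finite, 'd::finite) trajectory \<Rightarrow> bool" where
  "mt_solution \<phi> T x \<longleftrightarrow>
     (\<forall>t\<in>{0..T}. \<forall>i. mt_normalizer \<phi> (x t) i \<noteq> 0 \<and>
        ((\<lambda>s. x s i) has_vector_derivative mt_rhs \<phi> (x t) i) (at t within {0..T}))"

definition velocity ::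
    "real \<Rightarrow> ('n, 'd::finite) trajectory \<Rightarrow> real \<Rightarrow> 'n \<Rightarrow> real^'d" where
  "velocity T x t i = vector_derivative (\<lambda>s. x s i) (at t within {0..T})"

definition rel_pos :: "('n, 'd::finite) trajectory \<Rightarrow> real \<Rightarrow> 'n \<Rightarrow> 'n \<Rightarrow> real^'d" where
  "rel_pos x t i j = x t j - x t i"

definition block_entry ::
    "('k \<Rightarrow> real \<Rightarrow> real) \<Rightarrow> real \<Rightarrow> ('n::finite, 'd::finite) trajectory \<Rightarrow> real \<Rightarrow> 'n \<Rightarrow> 'k \<Rightarrow> real^'d"
  where
  "block_entry \<xi> T x t i k =
     (\<Sum>j\<in>UNIV. \<xi> k (norm (rel_pos x t i j)) *\<^sub>R (velocity T x t i - rel_pos x t i j))"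

text \<open>
  The stacked matrix has a number of rows that grows with the number \<open>M\<close> of trials, so its rows are
  indexed by the finite set \<open>stacked_rows M L\<close> of tuples (trial, observation time, agent,
  coordinate) instead of by a type.
\<close>

definition stacked_rows :: "nat \<Rightarrow> nat \<Rightarrow> (nat \<times> nat \<times> 'n::finite \<times> 'd::finite) set" where
  "stacked_rows M L = {1..M} \<times> {1..L} \<times> UNIV \<times> UNIV"

definition stacked_matrix ::
    "('k \<Rightarrow> real \<Rightarrow> real) \<Rightarrow> real \<Rightarrow> (nat \<Rightarrow> real) \<Rightarrow> (nat \<Rightarrow> ('n::finite, 'd::finite) trajectory) \<Rightarrow>
     nat \<times> nat \<times> 'n \<times> 'd \<Rightarrow> 'k \<Rightarrow> real" where
  "stacked_matrix \<xi> T t x = (\<lambda>(m, l, i, a) k. block_entry \<xi> T (x m) (t l) i k $ a)"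

text \<open>The product of the transpose of \<open>A\<close> with \<open>A\<close>, for a matrix \<open>A\<close> with row index set \<open>R\<close>.\<close>

definition transpose_times_self :: "'r set \<Rightarrow> ('r \<Rightarrow> 'k::finite \<Rightarrow> real) \<Rightarrow> real^'k^'k" where
  "transpose_times_self R A = (\<chi> k k'. \<Sum>r\<in>R. A r k * A r k')"

definition B_integrand ::
    "('k \<Rightarrow> real \<Rightarrow> real) \<Rightarrow> real \<Rightarrow> ('n::finite, 'd::finite) trajectory \<Rightarrow> real \<Rightarrow> 'k \<Rightarrow> 'k \<Rightarrow> real"
  where
  "B_integrand \<xi> T x t k k' =
     (\<Sum>i\<in>UNIV. \<Sum>j\<in>UNIV. \<Sum>j'\<in>UNIV.
        \<xi> k (norm (rel_pos x t i j)) * \<xi> k' (norm (rel_pos x t i j')) *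
        inner (velocity T x t i - rel_pos x t i j) (velocity T x t i - rel_pos x t i j'))"

text \<open>Law of an initial configuration whose positions are i.i.d. with law \<open>\<mu>\<^sub>0\<close>.\<close>

definition initial_law :: "(real^'d::finite) measure \<Rightarrow> ('n::finite, 'd) config measure" where
  "initial_law \<mu>\<^sub>0 = (\<Pi>\<^sub>M i\<in>UNIV. \<mu>\<^sub>0)"

text \<open>
  \<open>flow z\<close> is the trajectory issued from the initial configuration \<open>z\<close>; the expectation over a
  single trajectory is the integral over \<open>z\<close> with respect to \<open>initial_law \<mu>\<^sub>0\<close>.
\<close>

definition B_matrix ::
    "('k::finite \<Rightarrow> real \<Rightarrow> real) \<Rightarrow> real \<Rightarrow> nat \<Rightarrow> (nat \<Rightarrow> real) \<Rightarrow> (real^'d::finite) measure \<Rightarrow>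
     (('n::finite, 'd) config \<Rightarrow> ('n, 'd) trajectory) \<Rightarrow> real^'k^'k" where
  "B_matrix \<xi> T L t \<mu>\<^sub>0 flow =
     (\<chi> k k'. 1 / (real L * real CARD('n)) *
        (\<Sum>l = 1..L. \<integral>z. B_integrand \<xi> T (flow z) (t l) k k' \<partial>initial_law \<mu>\<^sub>0))"

end

theory Submission
  imports Defs
begin

text \<open>
  The normalised Gram matrix is an average over the trials of i.i.d. integrable random variables,
  so the limit is an instance of the strong law of large numbers; that the true coefficients lie in
  the kernel of the limit matrix is the equation of motion multiplied by its normalizer, and they are nonzero
  because the normalizers do not vanish.

  The strong law rests on the fact that a random walk \<open>S\<close> with integrable i.i.d. steps of negative
  mean is bounded above almost surely. Let \<open>W\<^sub>n = max (0, S\<^sub>1, \<dots>, S\<^sub>n)\<close> and let \<open>V\<^sub>n\<close> be the same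
  variable for the shifted steps. Then \<open>W\<^sub>n\<^sub>+\<^sub>1 = max 0 (X\<^sub>0 + V\<^sub>n)\<close>, and \<open>V\<^sub>n\<close>, \<open>W\<^sub>n\<close> have equal expectations,
  so \<open>0 \<le> E W\<^sub>n\<^sub>+\<^sub>1 - E V\<^sub>n = E (max (- V\<^sub>n) X\<^sub>0)\<close>. If the walk were unbounded with positive probability,
  it would be so almost surely by Kolmogorov's 0-1 law, and dominated convergence would give
  \<open>0 \<le> E X\<^sub>0\<close>.
\<close>

section \<open>The strong law of large numbers\<close>

text \<open>This is the maximum of \<open>0\<close> and the first \<open>n\<close> partial sums.
  Peeling off the first step instead of the last makes the comparison with the shifted walk hold by
  definition.\<close>

primrec walk_max :: "nat \<Rightarrow> (nat \<Rightarrow> real) \<Rightarrow> real" where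
  "walk_max 0 x = 0"
| "walk_max (Suc n) x = max 0 (x 0 + walk_max n (\<lambda>i. x (Suc i)))"

text \<open>Thresholds in \<open>nat\<close> keep all quantifiers countable, so that the event is
  measurable.\<close>

definition walk_unbounded :: "(nat \<Rightarrow> real) \<Rightarrow> bool" where
  "walk_unbounded x \<longleftrightarrow> (\<forall>k::nat. \<exists>n. real k < walk_max n x)"

lemma walk_max_nonneg: "0 \<le> walk_max n x"
  by (cases n) auto

lemma walk_max_le_Suc: "walk_max n x \<le> walk_max (Suc n) x"
proof (induction n arbitrary: x)
  case (Suc n)
  show ?case using Suc[of "\<lambda>i. x (Suc i)"] by (simp add: max_def)
qed simp

lemma walk_max_mono: "m \<le> n \<Longrightarrow> walk_max m x \<le> walk_max n x"
  by (rule lift_Suc_mono_le[of "\<lambda>n. walk_max n x", OF walk_max_le_Suc])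

lemma sum_le_walk_max: "(\<Sum>i<n. x i) \<le> walk_max n x"
proof (induction n arbitrary: x)
  case (Suc n)
  show ?case using Suc[of "\<lambda>i. x (Suc i)"] by (simp add: sum.lessThan_Suc_shift del: sum.lessThan_Suc)
qed simp

text \<open>Supplies the integrable majorant for the maxima.\<close>

lemma walk_max_le_sum_abs: "walk_max n x \<le> (\<Sum>i<n. \<bar>x i\<bar>)"
proof (induction n arbitrary: x)
  case (Suc n)
  have "0 \<le> (\<Sum>i<n. \<bar>x (Suc i)\<bar>)" by (simp add: sum_nonneg)
  then show ?case
    using Suc[of "\<lambda>i. x (Suc i)"] by (simp add: sum.lessThan_Suc_shift del: sum.lessThan_Suc)
qed simp

text \<open>A first step changes the maximum by a bounded amount only, so unboundedness is
  insensitive to it.\<close>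

lemma walk_unbounded_Suc: "walk_unbounded (\<lambda>i. x (Suc i)) \<longleftrightarrow> walk_unbounded x"
proof
  assume L: "walk_unbounded (\<lambda>i. x (Suc i))"
  show "walk_unbounded x"
    unfolding walk_unbounded_def
  proof
    fix k :: nat
    \<comment> \<open>The threshold is raised by an integer bound on the modulus of
      \<open>x 0\<close>, which absorbs a negative first step.\<close>
    obtain n where "real (k + nat \<lceil>\<bar>x 0\<bar>\<rceil>) < walk_max n (\<lambda>i. x (Suc i))"
      using L unfolding walk_unbounded_def by blast
    then have "real k < walk_max (Suc n) x" by simp linarith
    then show "\<exists>n. real k < walk_max n x" ..
  qed
next
  assume R: "walk_unbounded x"
  show "walk_unbounded (\<lambda>i. x (Suc i))"
    unfolding walk_unbounded_def
  proof
    fix k :: nat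
    obtain n where n: "real (k + nat \<lceil>\<bar>x 0\<bar>\<rceil>) < walk_max n x"
      using R unfolding walk_unbounded_def by blast
    \<comment> \<open>Positivity excludes \<open>n = 0\<close>, so there is a first step to
      remove.\<close>
    then have "0 < walk_max n x" by (metis of_nat_0_le_iff order_le_less_trans)
    then obtain m where "n = Suc m" by (cases n) auto
    with n have "real k < walk_max m (\<lambda>i. x (Suc i))" by simp linarith
    then show "\<exists>n. real k < walk_max n (\<lambda>i. x (Suc i))" ..
  qed
qed

lemma walk_unbounded_shift: "walk_unbounded (\<lambda>i. x (m + i)) \<longleftrightarrow> walk_unbounded x"
proof (induction m)
  case (Suc m)
  then show ?case using walk_unbounded_Suc[of "\<lambda>i. x (m + i)"] by simp
qed simp

lemma measurable_walk_max:
  assumes "\<And>i. X i \<in> borel_measurable M"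
  shows "(\<lambda>\<omega>. walk_max n (\<lambda>i. X i \<omega>)) \<in> borel_measurable M"
  using assms
proof (induction n arbitrary: X)
  case (Suc n)
  have [measurable]: "(\<lambda>\<omega>. walk_max n (\<lambda>i. X (Suc i) \<omega>)) \<in> borel_measurable M" "X 0 \<in> borel_measurable M"
    using Suc by auto
  show ?case by simp
qed simp

lemma measurable_walk_unbounded:
  assumes "\<And>i. X i \<in> borel_measurable M"
  shows "{\<omega> \<in> space M. walk_unbounded (\<lambda>i. X i \<omega>)} \<in> sets M"
proof -
  note [measurable] = measurable_walk_max[of X, OF assms]
  show ?thesis unfolding walk_unbounded_def by measurable
qed

lemma partial_sums_bounded:
  fixes x :: "nat \<Rightarrow> real"
  assumes "\<not> walk_unbounded x"
  obtains C where "\<And>n. (\<Sum>i<n. x i) \<le> C"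
  using assms unfolding walk_unbounded_def
  by (meson not_less order.trans sum_le_walk_max)

section \<open>Independent sequences, walks of negative drift and the strong law\<close>

context prob_space
begin

text \<open>For injective \<open>f\<close> the singletons \<open>{f j}\<close> are disjoint blocks
  of indices; grouping by blocks preserves independence, and each block has one coordinate to read
  off. It serves for shifts and for the agents of a fixed trial.\<close>

lemma indep_vars_reindex:
  assumes ind: "indep_vars N X I" and f: "inj_on f J" "f ` J \<subseteq> I"
  shows "indep_vars (\<lambda>j. N (f j)) (\<lambda>j. X (f j)) J"
proof -
  have "indep_vars (\<lambda>j. PiM {f j} N) (\<lambda>j \<omega>. restrict (\<lambda>i. X i \<omega>) {f j}) J"
    using f by (intro indep_vars_restrict[OF ind]) (auto simp: disjoint_family_on_def inj_on_def)
  then have "indep_vars (\<lambda>j. N (f j)) (\<lambda>j \<omega>. (\<lambda>y. y (f j)) (restrict (\<lambda>i. X i \<omega>) {f j})) J"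
    by (rule indep_vars_compose2) measurable
  then show ?thesis by simp
qed

lemma distr_iid_sequence:
  assumes ind: "indep_vars (\<lambda>_. N) X (UNIV :: nat set)"
    and law: "\<And>n. distr M N (X n) = D"
  shows "distr M (PiM UNIV (\<lambda>_. N)) (\<lambda>\<omega> n. X n \<omega>) = PiM UNIV (\<lambda>_. D)"
proof -
  have rv: "random_variable N (X i)" for i using ind by (auto simp: indep_vars_def)
  show ?thesis
    using ind indep_vars_iff_distr_eq_PiM[where I = UNIV and M' = "\<lambda>_. N" and X = X] rv
    by (simp add: law restrict_UNIV)
qed

text \<open>The sequence and its shift have the same joint law, the infinite power of the common
  marginal. This is what equates the expectations of \<open>V n\<close> and
  \<open>W n\<close>.\<close>

lemma expectation_iid_shift:
  fixes F :: "(nat \<Rightarrow> 'b) \<Rightarrow> real"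
  assumes ind: "indep_vars (\<lambda>_. N) X (UNIV :: nat set)"
    and law: "\<And>n. distr M N (X n) = distr M N (X 0)"
    and F: "F \<in> borel_measurable (PiM UNIV (\<lambda>_. N))"
  shows "expectation (\<lambda>\<omega>. F (\<lambda>i. X (Suc i) \<omega>)) = expectation (\<lambda>\<omega>. F (\<lambda>i. X i \<omega>))"
proof -
  have rv: "random_variable N (X i)" for i using ind by (auto simp: indep_vars_def)
  have ind': "indep_vars (\<lambda>_. N) (\<lambda>i. X (Suc i)) UNIV"
    using indep_vars_reindex[OF ind, of Suc UNIV] by simp
  have "distr M (PiM UNIV (\<lambda>_. N)) (\<lambda>\<omega> n. X n \<omega>) = distr M (PiM UNIV (\<lambda>_. N)) (\<lambda>\<omega> n. X (Suc n) \<omega>)"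
    using distr_iid_sequence[OF ind, of "distr M N (X 0)"] distr_iid_sequence[OF ind', of "distr M N (X 0)"] law
    by metis
  moreover have "expectation (\<lambda>\<omega>. F (\<lambda>i. X i \<omega>)) = (\<integral>y. F y \<partial>distr M (PiM UNIV (\<lambda>_. N)) (\<lambda>\<omega> n. X n \<omega>))"
    using rv F by (subst integral_distr) (auto intro!: measurable_PiM_single' measurable_space[OF rv])
  moreover have "expectation (\<lambda>\<omega>. F (\<lambda>i. X (Suc i) \<omega>)) = (\<integral>y. F y \<partial>distr M (PiM UNIV (\<lambda>_. N)) (\<lambda>\<omega> n. X (Suc n) \<omega>))"
    using rv F by (subst integral_distr) (auto intro!: measurable_PiM_single' measurable_space[OF rv])
  ultimately show ?thesis by simp
qed

lemma integrable_iff_distr_eq: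
  fixes X Y :: "'a \<Rightarrow> real"
  assumes "distr M borel X = distr M borel Y" "random_variable borel X" "random_variable borel Y"
  shows "integrable M X \<longleftrightarrow> integrable M Y"
  using integrable_distr_eq[OF assms(2), of "\<lambda>x. x"] integrable_distr_eq[OF assms(3), of "\<lambda>x. x"]
  unfolding assms(1) by simp

text \<open>Unboundedness survives the removal of any finite number of steps, so it is a tail
  event.\<close>

lemma walk_unbounded_0_1:
  assumes ind: "indep_vars (\<lambda>_. borel) X UNIV"
  shows "prob {\<omega> \<in> space M. walk_unbounded (\<lambda>i. X i \<omega>)} \<in> {0, 1}" (is "prob ?A \<in> _")
proof -
  have rv[measurable]: "random_variable borel (X i)" for i using ind by (auto simp: indep_vars_def)
  define F where "F i = sigma_sets (space M) {X i -` B \<inter> space M | B. B \<in> sets borel}" for i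
  have "?A \<in> tail_events F"
    unfolding tail_events_def
  proof
    fix m
    \<comment> \<open>\<open>N\<close> is generated by the steps from index \<open>m\<close> on; the
      general measurability lemma is applied to it in place of \<open>M\<close>.\<close>
    define N where "N = sigma (space M) (\<Union> (F ` {m..}))"
    have "F i \<subseteq> Pow (space M)" for i
      unfolding F_def by (intro subsetI PowI sigma_sets_into_sp) auto
    then have "\<Union> (F ` {m..}) \<subseteq> Pow (space M)" by blast
    then have N: "sets N = sigma_sets (space M) (\<Union> (F ` {m..}))" "space N = space M"
      by (auto simp: N_def)
    have "X (m + i) \<in> borel_measurable N" for i
    proof (rule measurableI)
      fix B :: "real set" assume "B \<in> sets borel"
      then have "X (m + i) -` B \<inter> space M \<in> F (m + i)" unfolding F_def by auto
      then show "X (m + i) -` B \<inter> space N \<in> sets N"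
        unfolding N by (intro sigma_sets.Basic) auto
    qed simp
    from measurable_walk_unbounded[OF this]
    have "{\<omega> \<in> space M. walk_unbounded (\<lambda>i. X (m + i) \<omega>)} \<in> sigma_sets (space M) (\<Union> (F ` {m..}))"
      by (simp only: N)
    then show "?A \<in> sigma_sets (space M) (\<Union> (F ` {m..}))"
      by (simp only: walk_unbounded_shift[where x = "\<lambda>i. X i \<omega>" and m = m for \<omega>])
  qed
  moreover have "indep_sets F UNIV" using ind unfolding F_def indep_vars_def by simp
  moreover have "sigma_algebra (space M) (F i)" for i
    unfolding F_def by (rule sigma_algebra_sigma_sets) auto
  ultimately show ?thesis
    using kolmogorov_0_1_law[of F ?A] by auto
qed

lemma walk_not_unbounded:
  assumes ind: "indep_vars (\<lambda>_. borel) X UNIV"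
    and law: "\<And>n. distr M borel (X n) = distr M borel (X 0)"
    and int: "integrable M (X 0)" and neg: "expectation (X 0) < 0"
  shows "AE \<omega> in M. \<not> walk_unbounded (\<lambda>i. X i \<omega>)"
proof (rule ccontr)
  let ?A = "{\<omega> \<in> space M. walk_unbounded (\<lambda>i. X i \<omega>)}"
  assume contra: "\<not> ?thesis"
  have rv[measurable]: "random_variable borel (X i)" for i using ind by (auto simp: indep_vars_def)
  have A[measurable]: "?A \<in> events" by (rule measurable_walk_unbounded) simp
  have intX: "integrable M (X i)" for i
    using int integrable_iff_distr_eq[OF law[of i] rv rv] by blast
  have "prob ?A \<noteq> 0"
    using contra A by (auto simp: prob_eq_0)
  then have AE: "AE \<omega> in M. walk_unbounded (\<lambda>i. X i \<omega>)"
    using walk_unbounded_0_1[OF ind] prob_eq_1[OF A] by simp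
  define W where "W n \<omega> = walk_max n (\<lambda>i. X i \<omega>)" for n \<omega>
  define V where "V n \<omega> = walk_max n (\<lambda>i. X (Suc i) \<omega>)" for n \<omega>
  have [measurable]: "W n \<in> borel_measurable M" "V n \<in> borel_measurable M" for n
    unfolding W_def V_def by (rule measurable_walk_max; simp)+
  have intW: "integrable M (W n)" for n
    by (rule Bochner_Integration.integrable_bound[of M "\<lambda>\<omega>. \<Sum>i<n. \<bar>X i \<omega>\<bar>"])
       (auto intro!: Bochner_Integration.integrable_sum integrable_abs intX order.trans[OF walk_max_le_sum_abs]
             simp: W_def walk_max_nonneg)
  have intV: "integrable M (V n)" for n
    by (rule Bochner_Integration.integrable_bound[of M "\<lambda>\<omega>. \<Sum>i<n. \<bar>X (Suc i) \<omega>\<bar>"])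
       (auto intro!: Bochner_Integration.integrable_sum integrable_abs intX
          order.trans[OF walk_max_le_sum_abs[of n "\<lambda>i. X (Suc i) _"]] simp: V_def walk_max_nonneg)
  have EV: "expectation (V n) = expectation (W n)" for n
    unfolding W_def V_def
    by (rule expectation_iid_shift[OF ind law]) (rule measurable_walk_max, simp)
  have nonneg: "0 \<le> expectation (\<lambda>\<omega>. max (- V n \<omega>) (X 0 \<omega>))" for n
  proof -
    have "expectation (V n) \<le> expectation (W (Suc n))"
      unfolding EV by (intro integral_mono intW) (simp add: W_def walk_max_le_Suc del: walk_max.simps)
    \<comment> \<open>The recursion gives \<open>W (Suc n) = max 0 (X 0 + V n)\<close>; subtracting
      \<open>V n\<close> moves it inside the maximum.\<close>
    moreover have "max (- V n \<omega>) (X 0 \<omega>) = W (Suc n) \<omega> - V n \<omega>" for \<omega>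
      by (simp add: W_def V_def max_def)
    ultimately show ?thesis using intW intV by simp
  qed
  have "(\<lambda>n. expectation (\<lambda>\<omega>. max (- V n \<omega>) (X 0 \<omega>))) \<longlonglongrightarrow> expectation (X 0)"
  proof (rule integral_dominated_convergence[where w = "\<lambda>\<omega>. \<bar>X 0 \<omega>\<bar>"])
    show "AE \<omega> in M. (\<lambda>n. max (- V n \<omega>) (X 0 \<omega>)) \<longlonglongrightarrow> X 0 \<omega>"
      using AE
    proof eventually_elim
      case (elim \<omega>)
      then have "walk_unbounded (\<lambda>i. X (Suc i) \<omega>)"
        by (simp only: walk_unbounded_Suc[of "\<lambda>i. X i \<omega>"])
      then obtain m where "real (nat \<lceil>\<bar>X 0 \<omega>\<bar>\<rceil>) < V m \<omega>"
        unfolding walk_unbounded_def V_def by blast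
      \<comment> \<open>Once \<open>V n\<close> exceeds the modulus of \<open>X 0\<close>,
        monotonicity keeps it there, so the sequence is eventually constant.\<close>
      then have "\<bar>X 0 \<omega>\<bar> < V n \<omega>" if "n \<ge> m" for n
        using walk_max_mono[OF that, of "\<lambda>i. X (Suc i) \<omega>"] unfolding V_def by linarith
      then have "max (- V n \<omega>) (X 0 \<omega>) = X 0 \<omega>" if "n \<ge> m" for n
        using that by (fastforce simp: max_def)
      then show ?case
        by (intro tendsto_eventually eventually_sequentiallyI)
    qed
    \<comment> \<open>As \<open>- V n\<close> is at most \<open>0\<close>, a nonnegative
      \<open>X 0\<close> is the maximum itself, and for a negative \<open>X 0\<close> the maximum
      lies between \<open>X 0\<close> and \<open>0\<close>.\<close>
    have "0 \<le> V n \<omega>" for n \<omega> by (simp add: V_def walk_max_nonneg)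
    then show "AE \<omega> in M. norm (max (- V n \<omega>) (X 0 \<omega>)) \<le> \<bar>X 0 \<omega>\<bar>" for n
      by (intro AE_I2) (smt (verit) real_norm_def)
    show "integrable M (\<lambda>\<omega>. \<bar>X 0 \<omega>\<bar>)" using int by simp
  qed measurable
  then have "0 \<le> expectation (X 0)"
    by (rule LIMSEQ_le_const) (use nonneg in blast)
  with neg show False by simp
qed

text \<open>With \<open>a\<close> strictly between the mean and \<open>b\<close>, the steps
  \<open>X i - a\<close> have negative mean; their partial sums stay below some \<open>C\<close>, so
  the averages are at most \<open>a + C / n\<close>.\<close>

lemma eventually_average_less:
  assumes ind: "indep_vars (\<lambda>_. borel) X UNIV"
    and law: "\<And>n. distr M borel (X n) = distr M borel (X 0)"
    and int: "integrable M (X 0)" and b: "expectation (X 0) < b"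
  shows "AE \<omega> in M. \<forall>\<^sub>F n in sequentially. (\<Sum>i<n. X i \<omega>) / real n < b"
proof -
  obtain a where a: "expectation (X 0) < a" "a < b" using dense[OF b] by auto
  have rv[measurable]: "random_variable borel (X i)" for i using ind by (auto simp: indep_vars_def)
  have "AE \<omega> in M. \<not> walk_unbounded (\<lambda>i. X i \<omega> - a)"
  proof (rule walk_not_unbounded)
    show "indep_vars (\<lambda>_. borel) (\<lambda>i \<omega>. X i \<omega> - a) UNIV"
      by (rule indep_vars_compose2[OF ind]) simp
    have "distr M borel (\<lambda>\<omega>. X n \<omega> - a) = distr (distr M borel (X n)) borel (\<lambda>x. x - a)" for n
      by (subst distr_distr) (auto simp: comp_def)
    then show "distr M borel (\<lambda>\<omega>. X n \<omega> - a) = distr M borel (\<lambda>\<omega>. X 0 \<omega> - a)" for n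
      by (metis law)
    show "expectation (\<lambda>\<omega>. X 0 \<omega> - a) < 0" using a int by (simp add: prob_space)
  qed (use int in auto)
  then show ?thesis
  proof eventually_elim
    case (elim \<omega>)
    obtain C where C: "\<And>n. (\<Sum>i<n. X i \<omega> - a) \<le> C"
      using partial_sums_bounded[OF elim] by blast
    have "(\<lambda>n. a + C / real n) \<longlonglongrightarrow> a + 0"
      by (intro tendsto_intros lim_const_over_n)
    then have "\<forall>\<^sub>F n in sequentially. a + C / real n < b"
      using a by (intro order_tendstoD) auto
    then show ?case
      using eventually_gt_at_top[of 0]
    proof eventually_elim
      case (elim n)
      have "(\<Sum>i<n. X i \<omega>) / real n \<le> a + C / real n"
        using C[of n] elim by (simp add: sum_subtractf field_simps)
      with elim show ?case by simp
    qed
  qed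
qed

text \<open>The one-sided bound is applied to \<open>X\<close> and to \<open>- X\<close>.\<close>

theorem strong_law_of_large_numbers:
  assumes ind: "indep_vars (\<lambda>_. borel) X UNIV"
    and law: "\<And>n. distr M borel (X n) = distr M borel (X 0)"
    and int: "integrable M (X 0)"
  shows "AE \<omega> in M. (\<lambda>n. (\<Sum>i<n. X i \<omega>) / real n) \<longlonglongrightarrow> expectation (X 0)"
proof -
  let ?\<mu> = "expectation (X 0)"
  have rv[measurable]: "random_variable borel (X i)" for i using ind by (auto simp: indep_vars_def)
  have neg: "indep_vars (\<lambda>_. borel) (\<lambda>i \<omega>. - X i \<omega>) UNIV"
    by (rule indep_vars_compose2[OF ind]) simp
  have "distr M borel (\<lambda>\<omega>. - X n \<omega>) = distr (distr M borel (X n)) borel uminus" for n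
    by (subst distr_distr) (auto simp: comp_def)
  then have law': "distr M borel (\<lambda>\<omega>. - X n \<omega>) = distr M borel (\<lambda>\<omega>. - X 0 \<omega>)" for n
    by (metis law)
  \<comment> \<open>Margins \<open>1 / (q + 1)\<close> form a countable family, so a single null set
    serves all of them.\<close>
  have "AE \<omega> in M. \<forall>q::nat. \<forall>\<^sub>F n in sequentially. (\<Sum>i<n. X i \<omega>) / real n < ?\<mu> + 1 / real (Suc q)"
    unfolding AE_all_countable by (intro allI eventually_average_less[OF ind law int]) simp
  moreover have "AE \<omega> in M. \<forall>q::nat. \<forall>\<^sub>F n in sequentially.
      (\<Sum>i<n. - X i \<omega>) / real n < - ?\<mu> + 1 / real (Suc q)"
    unfolding AE_all_countable using int by (intro allI eventually_average_less[OF neg law']) simp_all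
  ultimately show ?thesis
  proof eventually_elim
    case (elim \<omega>)
    show ?case
    proof (rule tendstoI)
      fix e :: real assume "0 < e"
      then obtain q where q: "1 / real (Suc q) < e" by (rule nat_approx_posE)
      show "\<forall>\<^sub>F n in sequentially. dist ((\<Sum>i<n. X i \<omega>) / real n) ?\<mu> < e"
        using elim(1)[rule_format, of q] elim(2)[rule_format, of q]
        by eventually_elim (use q in \<open>simp add: dist_real_def sum_negf abs_less_iff\<close>)
    qed
  qed
qed

section \<open>From independent agents to averages over independent trials\<close>

lemma indep_vars_rows:
  assumes ind: "indep_vars (\<lambda>_. N) (\<lambda>(m, i). X m i) (A \<times> UNIV)"
  shows "indep_vars (\<lambda>_. PiM (UNIV :: 'i set) (\<lambda>_. N)) (\<lambda>m \<omega> i. X m i \<omega>) A"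
proof -
  \<comment> \<open>The rows of the doubly indexed family are disjoint blocks of indices; afterwards
    the constant first index is dropped.\<close>
  have "indep_vars (\<lambda>m. PiM ({m} \<times> (UNIV :: 'i set)) (\<lambda>_. N))
      (\<lambda>m \<omega>. restrict (\<lambda>p. (case p of (m, i) \<Rightarrow> X m i) \<omega>) ({m} \<times> UNIV)) A"
    by (rule indep_vars_restrict[OF ind]) (auto simp: disjoint_family_on_def)
  then have "indep_vars (\<lambda>_. PiM (UNIV :: 'i set) (\<lambda>_. N))
      (\<lambda>m \<omega>. (\<lambda>f i. f (m, i)) (restrict (\<lambda>p. (case p of (m, i) \<Rightarrow> X m i) \<omega>) ({m} \<times> UNIV))) A"
    by (rule indep_vars_compose2)
       (auto intro!: measurable_PiM_single' simp: space_PiM PiE_iff)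
  then show ?thesis by simp
qed

text \<open>Trials are numbered from \<open>1\<close>, so the strong law is applied to
  \<open>g\<close> composed with \<open>Z (Suc m)\<close>.\<close>

lemma AE_average_tendsto:
  fixes g :: "'b \<Rightarrow> real"
  assumes ind: "indep_vars (\<lambda>_. N) Z {1::nat..}"
    and law: "\<And>m. m \<ge> 1 \<Longrightarrow> distr M N (Z m) = D"
    and int: "integrable D g"
  shows "AE \<omega> in M. (\<lambda>n. (\<Sum>m = 1..n. g (Z m \<omega>)) / real n) \<longlonglongrightarrow> (\<integral>z. g z \<partial>D)"
proof -
  have rv[measurable]: "random_variable N (Z (Suc m))" for m using ind by (auto simp: indep_vars_def)
  \<comment> \<open>\<open>D\<close> is the law of \<open>Z 1\<close> on \<open>N\<close>, so
    integrability under \<open>D\<close> carries measurability with respect to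
    \<open>N\<close>.\<close>
  have [measurable]: "g \<in> borel_measurable N"
    using borel_measurable_integrable[OF int] law[of 1] by (metis measurable_distr_eq1 order_refl)
  have "indep_vars (\<lambda>_. N) (\<lambda>m. Z (Suc m)) UNIV"
    using indep_vars_reindex[OF ind, of Suc UNIV] by auto
  then have "indep_vars (\<lambda>_. borel) (\<lambda>m \<omega>. g (Z (Suc m) \<omega>)) UNIV"
    by (rule indep_vars_compose2) measurable
  moreover have "distr M borel (\<lambda>\<omega>. g (Z (Suc m) \<omega>)) = distr D borel g" for m
    using law[of "Suc m"] by (subst distr_distr[of g N borel "Z (Suc m)", symmetric, unfolded comp_def]) simp_all
  moreover have "integrable M (\<lambda>\<omega>. g (Z (Suc 0) \<omega>))"
    using int law[of 1] integrable_distr_eq[of "Z 1" M N g] by simp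
  ultimately have "AE \<omega> in M. (\<lambda>n. (\<Sum>m<n. g (Z (Suc m) \<omega>)) / real n) \<longlonglongrightarrow> expectation (\<lambda>\<omega>. g (Z (Suc 0) \<omega>))"
    by (intro strong_law_of_large_numbers) auto
  moreover have "expectation (\<lambda>\<omega>. g (Z (Suc 0) \<omega>)) = (\<integral>z. g z \<partial>D)"
    using law[of 1] by (subst integral_distr[of "Z 1" M N g, symmetric, simplified]) simp_all
  moreover have "(\<Sum>m<n. g (Z (Suc m) \<omega>)) = (\<Sum>m = 1..n. g (Z m \<omega>))" for n \<omega>
    using sum.shift_bounds_Suc_ivl[of "\<lambda>m. g (Z m \<omega>)" 0 n]
    by (simp add: atLeast0LessThan atLeastLessThanSuc_atLeastAtMost)
  ultimately show ?thesis by simp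
qed

end

section \<open>The Gram identity and the kernel of the limit matrix\<close>

text \<open>The nullspace is the orthogonal complement of the row space, hence a line, and it
  contains the line through \<open>v\<close>.\<close>

lemma kernel_eq_span_of_rank:
  fixes A :: "real^'n^'m"
  assumes rank: "rank A = CARD('n) - 1" and v: "A *v v = 0" "v \<noteq> 0"
  shows "{x. A *v x = 0} = span {v}"
proof -
  let ?K = "{x. A *v x = 0}"
  have K: "?K = {y \<in> UNIV. \<forall>x \<in> span (rows A). orthogonal x y}"
  proof (intro set_eqI iffI)
    fix y assume "y \<in> {y \<in> UNIV. \<forall>x \<in> span (rows A). orthogonal x y}"
    then have "row i A \<bullet> y = 0" for i
      by (auto simp: orthogonal_def rows_def intro: span_base)
    then show "y \<in> ?K"
      by (simp add: vec_eq_iff matrix_vector_mul_component row_def)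
  qed (use orthogonal_nullspace_rowspace orthogonal_commute in blast)
  have "dim ?K + dim (span (rows A)) = dim (UNIV :: (real^'n) set)"
    unfolding K by (rule dim_subspace_orthogonal_to_vectors) auto
  moreover have "dim (span (rows A)) = CARD('n) - 1" using rank by (simp add: row_rank_def)
  \<comment> \<open>Subtraction on \<open>nat\<close> truncates; \<open>0 < CARD('n)\<close> ensures
    that the dimension comes out as \<open>1\<close>.\<close>
  moreover have "dim (UNIV :: (real^'n) set) = CARD('n)" "0 < CARD('n)" by simp_all
  ultimately have "dim ?K = 1" by linarith
  moreover have "dim (span {v}) = 1" using v(2) by (simp add: dim_insert)
  moreover have "subspace ?K"
    by (simp add: subspace_def matrix_vector_right_distrib matrix_vector_mult_scaleR)
  moreover have "span {v} \<subseteq> ?K" using v(1) \<open>subspace ?K\<close> by (simp add: span_minimal)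
  ultimately show ?thesis using subspace_dim_equal[of "span {v}" ?K] by simp
qed

section \<open>Locality in time and the Gram structure of the integrand\<close>

lemma has_vector_derivative_cong_on:
  assumes "\<And>s. s \<in> S \<Longrightarrow> f s = g s" "t \<in> S"
  shows "(f has_vector_derivative D) (at t within S) \<longleftrightarrow> (g has_vector_derivative D) (at t within S)"
  using assms has_vector_derivative_transform[of t S] by metis

text \<open>Velocities are derivatives within \<open>{0..T}\<close>, so values outside the interval
  do not matter. Trials are tied to \<open>flow\<close> on that interval only.\<close>

lemma B_integrand_cong:
  assumes eq: "\<And>s. s \<in> {0..T} \<Longrightarrow> x s = y s" and t: "t \<in> {0..T}"
  shows "B_integrand \<xi> T x t k k' = B_integrand \<xi> T y t k k'"
proof -
  have "velocity T x t i = velocity T y t i" for i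
    unfolding velocity_def vector_derivative_def
    using eq has_vector_derivative_cong_on[of "{0..T}" "\<lambda>s. x s i" "\<lambda>s. y s i" t] t by simp
  then show ?thesis
    using eq[OF t] by (simp add: B_integrand_def rel_pos_def)
qed

text \<open>Bilinearity collapses the sums over \<open>j\<close> and \<open>j'\<close> into one
  inner product of block entries.\<close>

lemma B_integrand_eq_inner:
  "B_integrand \<xi> T x t k k' = (\<Sum>i\<in>UNIV. block_entry \<xi> T x t i k \<bullet> block_entry \<xi> T x t i k')"
  unfolding B_integrand_def block_entry_def
  by (simp add: inner_sum_left) (simp add: inner_sum_right sum_distrib_left mult.assoc mult.left_commute)

text \<open>Summing over coordinates gives inner products, and summing over agents gives the
  integrand. Observation times are put outermost to match \<open>B_matrix\<close>.\<close>

lemma transpose_times_self_stacked: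
  fixes x :: "nat \<Rightarrow> ('n::finite, 'd::finite) trajectory"
  shows "transpose_times_self (stacked_rows M L) (stacked_matrix \<xi> T t x) $ k $ k' =
    (\<Sum>l = 1..L. \<Sum>m = 1..M. B_integrand \<xi> T (x m) (t l) k k')"
  by (subst sum.swap)
     (simp add: transpose_times_self_def stacked_rows_def stacked_matrix_def sum.cartesian_product'
       B_integrand_eq_inner inner_vec_def flip: UNIV_Times_UNIV)

section \<open>The true coefficients annihilate the limit matrix\<close>

lemma velocity_eq_rhs:
  assumes "mt_solution \<phi> T x" "t \<in> {0..T}" "0 < T"
  shows "velocity T x t i = mt_rhs \<phi> (x t) i"
  unfolding velocity_def
  \<comment> \<open>With \<open>0 < T\<close> the interval is nondegenerate, so derivatives within
    it are unique, also at the end points.\<close>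
  by (rule vector_derivative_within_closed_interval) (use assms in \<open>auto simp: mt_solution_def\<close>)

lemma block_combination_zero:
  fixes x :: "('n::finite, 'd::finite) trajectory"
  assumes sol: "mt_solution \<phi> T x" and t: "t \<in> {0..T}" "0 < T"
    and kernel: "\<And>r. r \<ge> 0 \<Longrightarrow> \<phi> r = (\<Sum>k\<in>UNIV. c $ k * \<xi> k r)"
  shows "(\<Sum>k\<in>UNIV. c $ k *\<^sub>R block_entry \<xi> T x t i k) = 0"
proof -
  let ?N = "mt_normalizer \<phi> (x t) i" and ?v = "velocity T x t i"
  have N: "?N \<noteq> 0" using sol t unfolding mt_solution_def by auto
  have "(\<Sum>k\<in>UNIV. c $ k *\<^sub>R block_entry \<xi> T x t i k) =
      (\<Sum>j\<in>UNIV. \<phi> (norm (rel_pos x t i j)) *\<^sub>R (?v - rel_pos x t i j))"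
    unfolding block_entry_def
    by (simp add: scaleR_sum_right kernel scaleR_sum_left) (rule sum.swap)
  also have "\<dots> = ?N *\<^sub>R ?v - (\<Sum>j\<in>UNIV. \<phi> (norm (rel_pos x t i j)) *\<^sub>R rel_pos x t i j)"
    by (simp add: scaleR_diff_right sum_subtractf mt_normalizer_def scaleR_sum_left rel_pos_def)
  \<comment> \<open>The normalizer cancels the denominator in \<open>mt_rhs\<close> because it is
    nonzero along a solution.\<close>
  also have "?N *\<^sub>R ?v = (\<Sum>j\<in>UNIV. \<phi> (norm (rel_pos x t i j)) *\<^sub>R rel_pos x t i j)"
    using N by (simp add: velocity_eq_rhs[OF sol t] mt_rhs_def scaleR_sum_right rel_pos_def)
  finally show ?thesis by simp
qed

lemma B_integrand_combination_zero:
  fixes x :: "('n::finite, 'd::finite) trajectory"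
  assumes "mt_solution \<phi> T x" "t \<in> {0..T}" "0 < T"
    and "\<And>r. r \<ge> 0 \<Longrightarrow> \<phi> r = (\<Sum>k\<in>UNIV. c $ k * \<xi> k r)"
  shows "(\<Sum>k'\<in>UNIV. c $ k' * B_integrand \<xi> T x t k k') = 0"
proof -
  have "(\<Sum>k'\<in>UNIV. c $ k' * B_integrand \<xi> T x t k k') =
      (\<Sum>i\<in>UNIV. block_entry \<xi> T x t i k \<bullet> (\<Sum>k'\<in>UNIV. c $ k' *\<^sub>R block_entry \<xi> T x t i k'))"
    unfolding B_integrand_eq_inner
    by (simp add: inner_sum_right sum_distrib_left) (rule sum.swap)
  then show ?thesis using block_combination_zero[OF assms] by simp
qed

text \<open>The pathwise identity is integrated; integrability lets the finite combination pass
  through the integral.\<close>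

lemma B_matrix_mult_eq_0:
  fixes flow :: "('n::finite, 'd::finite) config \<Rightarrow> ('n, 'd) trajectory"
  assumes sol: "AE z in initial_law \<mu>\<^sub>0. mt_solution \<phi> T (flow z)"
    and int: "\<And>l k k'. l \<in> {1..L} \<Longrightarrow>
         integrable (initial_law \<mu>\<^sub>0) (\<lambda>z. B_integrand \<xi> T (flow z) (t l) k k')"
    and t: "\<And>l. l \<in> {1..L} \<Longrightarrow> t l \<in> {0..T}" "0 < T"
    and kernel: "\<And>r. r \<ge> 0 \<Longrightarrow> \<phi> r = (\<Sum>k\<in>UNIV. c $ k * \<xi> k r)"
  shows "B_matrix \<xi> T L t \<mu>\<^sub>0 flow *v c = 0"
proof -
  let ?I = "\<lambda>l k k'. \<integral>z. B_integrand \<xi> T (flow z) (t l) k k' \<partial>initial_law \<mu>\<^sub>0"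
  have "(\<Sum>k'\<in>UNIV. c $ k' * ?I l k k') = 0" if l: "l \<in> {1..L}" for l k
  proof -
    have "(\<Sum>k'\<in>UNIV. c $ k' * ?I l k k') =
        (\<integral>z. (\<Sum>k'\<in>UNIV. c $ k' * B_integrand \<xi> T (flow z) (t l) k k') \<partial>initial_law \<mu>\<^sub>0)"
      using int[OF l] by simp
    also have "\<dots> = 0"
      by (rule integral_eq_zero_AE, use sol in eventually_elim)
         (rule B_integrand_combination_zero[OF _ t(1)[OF l] t(2) kernel])
    finally show ?thesis .
  qed
  then have "(\<Sum>k'\<in>UNIV. (\<Sum>l = 1..L. ?I l k k') * c $ k') = 0" for k
    unfolding sum_distrib_right by (subst sum.swap) (simp add: mult.commute)
  moreover have "(B_matrix \<xi> T L t \<mu>\<^sub>0 flow *v c) $ k =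
      1 / (real L * real CARD('n)) * (\<Sum>k'\<in>UNIV. (\<Sum>l = 1..L. ?I l k k') * c $ k')" for k
    by (simp add: matrix_vector_mult_def B_matrix_def sum_divide_distrib[symmetric])
  ultimately show ?thesis by (simp add: vec_eq_iff)
qed

text \<open>All trials share one \<open>flow\<close>, so the sums over trials apply fixed
  functionals to i.i.d. initial configurations.\<close>

theorem proposition2:
  fixes \<xi> :: "'k::finite \<Rightarrow> real \<Rightarrow> real"
    and \<phi> :: "real \<Rightarrow> real"
    and c_true :: "real^'k"
    and L :: nat and t :: "nat \<Rightarrow> real" and T :: real
    and \<mu>\<^sub>0 :: "(real^'d::finite) measure"
    and flow :: "('n::finite, 'd) config \<Rightarrow> ('n, 'd) trajectory"
    and P :: "'w measure"
    and x0 :: "nat \<Rightarrow> 'n \<Rightarrow> 'w \<Rightarrow> real^'d"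
    and x :: "nat \<Rightarrow> 'w \<Rightarrow> ('n, 'd) trajectory"
  assumes kernel: "\<And>r. r \<ge> 0 \<Longrightarrow> \<phi> r = (\<Sum>k\<in>UNIV. c_true $ k * \<xi> k r)"
    and times: "L \<ge> 2" "t 1 = 0" "strict_mono_on {1..L} t" "t L = T"
    and mu0: "prob_space \<mu>\<^sub>0" "sets \<mu>\<^sub>0 = sets borel"
    and flow: "AE z in initial_law \<mu>\<^sub>0. flow z 0 = z \<and> mt_solution \<phi> T (flow z)"
    and finite_expectation:
      "\<And>l k k'. l \<in> {1..L} \<Longrightarrow>
         integrable (initial_law \<mu>\<^sub>0) (\<lambda>z. B_integrand \<xi> T (flow z) (t l) k k')"
    and P: "prob_space P"
    and iid_indep:
      "prob_space.indep_vars P (\<lambda>_. borel) (\<lambda>(m, i). x0 m i) ({1..} \<times> UNIV)"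
    and iid_law: "\<And>m i. m \<ge> 1 \<Longrightarrow> distr P borel (x0 m i) = \<mu>\<^sub>0"
    and trajectories:
      "\<And>m. m \<ge> 1 \<Longrightarrow> AE \<omega> in P. \<forall>s\<in>{0..T}. x m \<omega> s = flow (\<lambda>i. x0 m i \<omega>) s"
  shows "(AE \<omega> in P.
            (\<lambda>M. (1 / (real CARD('n) * real M * real L)) *\<^sub>R
               transpose_times_self (stacked_rows M L) (stacked_matrix \<xi> T t (\<lambda>m. x m \<omega>)))
            \<longlonglongrightarrow> B_matrix \<xi> T L t \<mu>\<^sub>0 flow)
       \<and> (rank (B_matrix \<xi> T L t \<mu>\<^sub>0 flow) = CARD('k) - 1 \<longrightarrow>
            {v. B_matrix \<xi> T L t \<mu>\<^sub>0 flow *v v = 0} = span {c_true})"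
proof
  interpret P: prob_space P by (rule P)
  interpret \<mu>: prob_space \<mu>\<^sub>0 by (rule mu0)
  interpret I: product_prob_space "\<lambda>_::'n. \<mu>\<^sub>0" UNIV ..
  let ?I = "initial_law \<mu>\<^sub>0 :: ('n, 'd) config measure"
  let ?B = "B_matrix \<xi> T L t \<mu>\<^sub>0 flow"
  let ?Z = "\<lambda>m \<omega> i. x0 m i \<omega>"
  have t_mono: "t l \<le> t l'" if "l \<in> {1..L}" "l' \<in> {1..L}" "l \<le> l'" for l l'
    using times(3) that strict_mono_onD[OF times(3), of l l'] by (cases "l = l'") auto
  have t: "t l \<in> {0..T}" if "l \<in> {1..L}" for l
    using t_mono[of 1 l] t_mono[of l L] that times by auto
  have T: "0 < T" using strict_mono_onD[OF times(3), of 1 L] times by auto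
  have Z_ind: "P.indep_vars (\<lambda>_. PiM UNIV (\<lambda>_. borel)) ?Z {1..}"
    by (rule P.indep_vars_rows[OF iid_indep])
  have Z_law: "distr P (PiM UNIV (\<lambda>_. borel)) (?Z m) = ?I" if m: "m \<ge> 1" for m
  proof -
    have ind: "P.indep_vars (\<lambda>_. borel) (\<lambda>i. x0 m i) UNIV"
      using P.indep_vars_reindex[OF iid_indep, of "Pair m" UNIV] m by (auto simp: inj_on_def)
    have rv: "x0 m i \<in> borel_measurable P" for i using ind by (auto simp: P.indep_vars_def)
    show ?thesis
      using P.indep_vars_iff_distr_eq_PiM[where I = UNIV and M' = "\<lambda>_. borel" and X = "x0 m"] ind rv
      by (simp add: iid_law[OF m] restrict_UNIV initial_law_def)
  qed
  \<comment> \<open>There are finitely many \<open>l\<close>, \<open>k\<close> and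
    \<open>k'\<close>, so one null set covers all entries; below, countably many trials are treated
    likewise.\<close>
  have "AE \<omega> in P. \<forall>l\<in>{1..L}. \<forall>k k'. (\<lambda>M. (\<Sum>m = 1..M. B_integrand \<xi> T (flow (?Z m \<omega>)) (t l) k k') / real M)
      \<longlonglongrightarrow> (\<integral>z. B_integrand \<xi> T (flow z) (t l) k k' \<partial>?I)"
    by (intro AE_finite_allI finite_atLeastAtMost AE_all_countable[THEN iffD2] allI
          P.AE_average_tendsto[OF Z_ind Z_law] finite_expectation)
  moreover have "AE \<omega> in P. \<forall>m\<in>{1..}. \<forall>s\<in>{0..T}. x m \<omega> s = flow (?Z m \<omega>) s"
    by (rule AE_ball_countable[THEN iffD2]) (use trajectories in auto)
  ultimately show "AE \<omega> in P.
      (\<lambda>M. (1 / (real CARD('n) * real M * real L)) *\<^sub>R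
         transpose_times_self (stacked_rows M L) (stacked_matrix \<xi> T t (\<lambda>m. x m \<omega>))) \<longlonglongrightarrow> ?B"
  proof eventually_elim
    case (elim \<omega>)
    show ?case
    proof (intro vec_tendstoI)
      fix k k'
      have eq: "(\<Sum>l = 1..L. \<Sum>m = 1..M. B_integrand \<xi> T (x m \<omega>) (t l) k k') =
          (\<Sum>l = 1..L. \<Sum>m = 1..M. B_integrand \<xi> T (flow (?Z m \<omega>)) (t l) k k')" for M
        using elim(2) t by (intro sum.cong refl B_integrand_cong) auto
      \<comment> \<open>For \<open>M = 0\<close> both sides vanish through \<open>x / 0 = 0\<close>,
        so the identity holds for every \<open>M\<close>.\<close>
      have "((1 / (real CARD('n) * real M * real L)) *\<^sub>R
            transpose_times_self (stacked_rows M L) (stacked_matrix \<xi> T t (\<lambda>m. x m \<omega>))) $ k $ k' =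
          1 / (real L * real CARD('n)) *
            (\<Sum>l = 1..L. (\<Sum>m = 1..M. B_integrand \<xi> T (flow (?Z m \<omega>)) (t l) k k') / real M)" for M
        by (simp only: vector_scaleR_component transpose_times_self_stacked eq)
           (simp add: sum_divide_distrib[symmetric] ac_simps)
      moreover have "(\<lambda>M. 1 / (real L * real CARD('n)) *
            (\<Sum>l = 1..L. (\<Sum>m = 1..M. B_integrand \<xi> T (flow (?Z m \<omega>)) (t l) k k') / real M))
          \<longlonglongrightarrow> ?B $ k $ k'"
        unfolding B_matrix_def using elim(1)
        by (simp only: vec_lambda_beta) (intro tendsto_intros; simp)
      ultimately show "(\<lambda>M. ((1 / (real CARD('n) * real M * real L)) *\<^sub>R
            transpose_times_self (stacked_rows M L) (stacked_matrix \<xi> T t (\<lambda>m. x m \<omega>))) $ k $ k')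
          \<longlonglongrightarrow> ?B $ k $ k'"
        by simp
    qed
  qed
  have I: "prob_space ?I" unfolding initial_law_def by (rule I.prob_space_axioms)
  have sol: "AE z in ?I. mt_solution \<phi> T (flow z)" using flow by eventually_elim simp
  have "?B *v c_true = 0"
    by (rule B_matrix_mult_eq_0[OF sol finite_expectation t T kernel])
  moreover have "c_true \<noteq> 0"
  proof
    assume "c_true = 0"
    then have "\<phi> r = 0" if "r \<ge> 0" for r using kernel[OF that] by simp
    \<comment> \<open>A kernel vanishing on nonnegative arguments makes every normalizer zero,
      already at time \<open>0\<close>.\<close>
    then have "\<not> mt_solution \<phi> T y" for y :: "('n, 'd) trajectory"
      using T by (auto simp: mt_solution_def mt_normalizer_def intro!: bexI[of _ 0])
    with sol have "AE z in ?I. False" by simp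
    then show False using prob_space.AE_False[OF I] by simp
  qed
  ultimately show "rank ?B = CARD('k) - 1 \<longrightarrow> {v. ?B *v v = 0} = span {c_true}"
    using kernel_eq_span_of_rank by blast
qed

end
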